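(* Assume that $\beta\ne0$ and that all the points $x_1,\dots,x_N$ lie in one plane orthogonal to $\beta$. Let $E\subset\{1,\dots,N\}$ and $a=a_E$. Then for every $h>0$ there exists $(q_h,p_h)\in H^2$ such that $(q_h,p_h,\pi_a)$ is a fixed point of the Hamiltonian system. Assuming moreover $\beta=(0,0,|\beta|)$ and setting $\varepsilon_\lambda=1$ if $\lambda\in E$ and $\varepsilon_\lambda=-1$ otherwise, the energy level of the fixed point is $$\mathbf H(q_h,p_h,\pi_a)=h|\beta|\sum_{\lambda=1}^N\varepsilon_\lambda-\frac{h^2}{2}\sum_{\lambda,\mu\le N}C_{33}^{[\lambda,\mu]}\varepsilon_\lambda\varepsilon_\mu,$$ with $$C_{33}^{[\lambda,\mu]}=(2\pi)^{-3}\int_{\mathbb R^3}|\chi(|k|)|^2\cos(k\cdot(x_\lambda-x_\mu))\frac{k_1^2+k_2^2}{|k|^2}\,dk.$$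
   Context: $H$ is the real Hilbert space of $f=(f_1,f_2,f_3):\mathbb R^3\to\mathbb R^3$ with $f_j\in L^2(\mathbb R^3)$ real valued and $k\cdot f(k)=0$ a.e., with $|f|^2=\sum_j\int|f_j(k)|^2dk$ and scalar product $\cdot$. $M$ is multiplication by $|k|$ in $H$, with domain $D(M)$. $\chi\in\mathcal S(\mathbb R)$ is a fixed real-valued function vanishing near $0$; $(e_1,e_2,e_3)$ is the canonical basis of $\mathbb R^3$; $\wedge$ is the cross product. For $x\in\mathbb R^3$, $m=1,2,3$, $$a_m(x)(k)=\frac{\chi(|k|)|k|^{1/2}}{(2\pi)^{3/2}}\sin(k\cdot x)\frac{k\wedge e_m}{|k|},\qquad b_m(x)(k)=\frac{\chi(|k|)|k|^{1/2}}{(2\pi)^{3/2}}\cos(k\cdot x)\frac{k\wedge e_m}{|k|},$$ and $B_m(x,q,p)=a_m(x)\cdot q+b_m(x)\cdot p$ for $(q,p)\in H^2$. $x_1,\dots,x_N\in\mathbb R^3$ and $\beta=(\beta_1,\beta_2,\beta_3)\in\mathbb R^3$ are fixed (constant magnetic field). $\mathcal H_{sp}=(\mathbb C^2)^{\otimes N}$; $\sigma_m^{[\lambda]}$ is the Pauli matrix $\sigma_m$ acting on the $\lambda$-th factor. $\mathcal G$ is the Lie algebra of $SU(2^N)=SU(\mathcal H_{sp})$ (traceless antihermitian maps), $\mathcal G^\star$ its dual; for a unit vector $a\in\mathcal H_{sp}$, $\langle\pi_a,Y\rangle=i^{-1}\langle Ya,a\rangle$. The Hamiltonian function is $$\mathbf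 H(q,p,\omega)=\tfrac12\int_{\mathbb R^3}|k|(|q(k)|^2+|p(k)|^2)dk+h\sum_{\lambda,m}(\beta_m+B_m(x_\lambda,q,p))\langle\omega,i\sigma_m^{[\lambda]}\rangle,$$ and the Hamiltonian system is $q'=Mp+h\sum_{\lambda,m}b_m(x_\lambda)\langle\omega,i\sigma_m^{[\lambda]}\rangle$, $p'=-Mq-h\sum_{\lambda,m}a_m(x_\lambda)\langle\omega,i\sigma_m^{[\lambda]}\rangle$, $\frac{d}{dt}\langle\omega,Y\rangle=\sum_{\lambda,m}(\beta_m+B_m(x_\lambda,q,p))\langle\omega,[i\sigma_m^{[\lambda]},Y]\rangle$ for all $Y\in\mathcal G$. A fixed point is a point $(q,p,\omega)$ (then $q,p\in D(M)$) at which the three right-hand sides vanish. Unit vectors $b_0,b_1\in\mathbb C^2$ are chosen with $\sum_m\beta_m\sigma_mb_0=-|\beta|b_0$ and $\sum_m\beta_m\sigma_mb_1=+|\beta|b_1$. For $E\subset\{1,\dots,N\}$, $a_E=a_1\otimes\cdots\otimes a_N$ with $a_j=b_1$ if $j\in E$ and $a_j=b_0$ if $j\notin E$. *)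

theory Defs
  imports "HOL-Analysis.Analysis"
begin

section \<open>Schwartz functions on the line\<close>

definition schwartz :: "(real \<Rightarrow> real) \<Rightarrow> bool" where
  "schwartz f \<longleftrightarrow>
     (\<forall>n t. (deriv ^^ n) f field_differentiable (at t)) \<and>
     (\<forall>m n. bounded (range (\<lambda>t. t ^ m * (deriv ^^ n) f t)))"

definition vanishes_near_zero :: "(real \<Rightarrow> real) \<Rightarrow> bool" where
  "vanishes_near_zero f \<longleftrightarrow> eventually (\<lambda>t. f t = 0) (nhds 0)"

section \<open>The Hilbert space of transverse square integrable fields\<close>

text \<open>Elements of the Hilbert space are given by representatives; two representatives
  denote the same element iff they agree almost everywhere, so an equation between elements
  is an equation a.e.\<close>

type_synonym field3 = "real^3 \<Rightarrow> real^3"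

definition Hspace :: "field3 set" where
  "Hspace = {f. f \<in> borel_measurable lborel \<and>
                (\<forall>j. integrable lborel (\<lambda>k. (f k $ j)\<^sup>2)) \<and>
                (AE k in lborel. k \<bullet> f k = 0)}"

definition Hinner :: "field3 \<Rightarrow> field3 \<Rightarrow> real" where
  "Hinner f g = (\<Sum>j\<in>UNIV. LINT k|lborel. f k $ j * g k $ j)"

definition Mop :: "field3 \<Rightarrow> field3" where
  "Mop f = (\<lambda>k. norm k *\<^sub>R f k)"

definition dom_M :: "field3 set" where
  "dom_M = {f \<in> Hspace. Mop f \<in> Hspace}"

definition a_field :: "(real \<Rightarrow> real) \<Rightarrow> 3 \<Rightarrow> real^3 \<Rightarrow> field3" where
  "a_field chi m x = (\<lambda>k.
     (chi (norm k) * sqrt (norm k) / (2 * pi) powr (3/2) * sin (k \<bullet> x) / norm k)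
       *\<^sub>R cross3 k (axis m 1))"

definition b_field :: "(real \<Rightarrow> real) \<Rightarrow> 3 \<Rightarrow> real^3 \<Rightarrow> field3" where
  "b_field chi m x = (\<lambda>k.
     (chi (norm k) * sqrt (norm k) / (2 * pi) powr (3/2) * cos (k \<bullet> x) / norm k)
       *\<^sub>R cross3 k (axis m 1))"

definition B_field :: "(real \<Rightarrow> real) \<Rightarrow> 3 \<Rightarrow> real^3 \<Rightarrow> field3 \<Rightarrow> field3 \<Rightarrow> real" where
  "B_field chi m x q p = Hinner (a_field chi m x) q + Hinner (b_field chi m x) p"

section \<open>The spin space\<close>

text \<open>The particles are indexed by a finite type \<^typ>\<open>'n\<close> with \<open>N\<close> elements. The \<open>N\<close>-fold tensor
  power of \<open>\<complex>\<^sup>2\<close> is given by coordinates in its standard product basis, whose vectors are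
  indexed by the functions \<open>s :: 'n \<Rightarrow> 2\<close>. The index type \<^typ>\<open>2\<close> has the elements 1 and 2 (= 0).\<close>

type_synonym 'n spin = "complex ^ ('n \<Rightarrow> 2)"
type_synonym 'n spin_op = "complex ^ ('n \<Rightarrow> 2) ^ ('n \<Rightarrow> 2)"

definition tensor_vec :: "('n::finite \<Rightarrow> complex^2) \<Rightarrow> 'n spin" where
  "tensor_vec v = (\<chi> s. \<Prod>l\<in>UNIV. v l $ s l)"

definition tensor_op :: "('n::finite \<Rightarrow> complex^2^2) \<Rightarrow> 'n spin_op" where
  "tensor_op A = (\<chi> s t. \<Prod>l\<in>UNIV. A l $ s l $ t l)"

lemma tensor_op_tensor_vec:
  fixes A :: "'n::finite \<Rightarrow> complex^2^2"
  shows "tensor_op A *v tensor_vec v = tensor_vec (\<lambda>l. A l *v v l)"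
proof -
  have "(\<Sum>t\<in>UNIV. (\<Prod>l\<in>UNIV. A l $ s l $ t l) * (\<Prod>l\<in>UNIV. v l $ t l))
      = (\<Prod>l\<in>UNIV. \<Sum>j\<in>UNIV. A l $ s l $ j * v l $ j)" for s
    using prod_sum_PiE[of "UNIV :: 'n set" "\<lambda>_. UNIV :: 2 set" "\<lambda>l j. A l $ s l $ j * v l $ j"]
    by (simp add: prod.distrib)
  then show ?thesis
    by (simp add: vec_eq_iff matrix_vector_mult_def tensor_op_def tensor_vec_def)
qed

definition on_factor :: "'n::finite \<Rightarrow> complex^2^2 \<Rightarrow> 'n spin_op" where
  "on_factor l A = tensor_op (\<lambda>r. if r = l then A else mat 1)"

text \<open>The last case is \<open>m = 3\<close>.\<close>

definition pauli :: "3 \<Rightarrow> complex^2^2" where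
  "pauli m =
     (if m = 1 then vector [vector [0, 1], vector [1, 0]]
      else if m = 2 then vector [vector [0, - \<i>], vector [\<i>, 0]]
      else vector [vector [1, 0], vector [0, - 1]])"

definition i_sigma :: "3 \<Rightarrow> 'n::finite \<Rightarrow> 'n spin_op" where
  "i_sigma m l = map_matrix (\<lambda>z. \<i> * z) (on_factor l (pauli m))"

definition hermitian_inner :: "complex ^ 'i::finite \<Rightarrow> complex ^ 'i \<Rightarrow> complex" where
  "hermitian_inner u v = (\<Sum>i\<in>UNIV. u $ i * cnj (v $ i))"

definition adj :: "complex ^ 'i::finite ^ 'i \<Rightarrow> complex ^ 'i ^ 'i" where
  "adj A = map_matrix cnj (transpose A)"

definition commutator :: "complex ^ 'i::finite ^ 'i \<Rightarrow> complex ^ 'i ^ 'i \<Rightarrow> complex ^ 'i ^ 'i" where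
  "commutator A B = A ** B - B ** A"

definition lie_G :: "('n::finite) spin_op set" where
  "lie_G = {Y. adj Y = - Y \<and> trace Y = 0}"

text \<open>Elements of the dual are represented by functions on all matrices that are real linear
  on \<open>lie_G\<close>; their values outside \<open>lie_G\<close> are irrelevant.\<close>

definition dual_G :: "(('n::finite) spin_op \<Rightarrow> real) set" where
  "dual_G = {\<omega>. (\<forall>X\<in>lie_G. \<forall>Y\<in>lie_G. \<omega> (X + Y) = \<omega> X + \<omega> Y) \<and>
                 (\<forall>c. \<forall>X\<in>lie_G. \<omega> (c *\<^sub>R X) = c * \<omega> X)}"

text \<open>For antihermitian \<open>Y\<close> the number under \<^const>\<open>Re\<close> is real.\<close>

definition pure_state :: "('n::finite) spin \<Rightarrow> 'n spin_op \<Rightarrow> real" where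
  "pure_state a Y = Re (inverse \<i> * hermitian_inner (Y *v a) a)"

section \<open>The Hamiltonian system\<close>

definition energy ::
  "(real \<Rightarrow> real) \<Rightarrow> ('n::finite \<Rightarrow> real^3) \<Rightarrow> real^3 \<Rightarrow> real
    \<Rightarrow> field3 \<Rightarrow> field3 \<Rightarrow> ('n spin_op \<Rightarrow> real) \<Rightarrow> real" where
  "energy chi x \<beta> h q p \<omega> =
     1 / 2 * (LINT k|lborel. norm k * ((norm (q k))\<^sup>2 + (norm (p k))\<^sup>2))
     + h * (\<Sum>l\<in>UNIV. \<Sum>m\<in>UNIV. (\<beta> $ m + B_field chi m (x l) q p) * \<omega> (i_sigma m l))"

definition rhs_q ::
  "(real \<Rightarrow> real) \<Rightarrow> ('n::finite \<Rightarrow> real^3) \<Rightarrow> real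
    \<Rightarrow> field3 \<Rightarrow> field3 \<Rightarrow> ('n spin_op \<Rightarrow> real) \<Rightarrow> field3" where
  "rhs_q chi x h q p \<omega> = (\<lambda>k.
     Mop p k + h *\<^sub>R (\<Sum>l\<in>UNIV. \<Sum>m\<in>UNIV. \<omega> (i_sigma m l) *\<^sub>R b_field chi m (x l) k))"

definition rhs_p ::
  "(real \<Rightarrow> real) \<Rightarrow> ('n::finite \<Rightarrow> real^3) \<Rightarrow> real
    \<Rightarrow> field3 \<Rightarrow> field3 \<Rightarrow> ('n spin_op \<Rightarrow> real) \<Rightarrow> field3" where
  "rhs_p chi x h q p \<omega> = (\<lambda>k.
     - Mop q k - h *\<^sub>R (\<Sum>l\<in>UNIV. \<Sum>m\<in>UNIV. \<omega> (i_sigma m l) *\<^sub>R a_field chi m (x l) k))"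

definition rhs_omega ::
  "(real \<Rightarrow> real) \<Rightarrow> ('n::finite \<Rightarrow> real^3) \<Rightarrow> real^3
    \<Rightarrow> field3 \<Rightarrow> field3 \<Rightarrow> ('n spin_op \<Rightarrow> real) \<Rightarrow> 'n spin_op \<Rightarrow> real" where
  "rhs_omega chi x \<beta> q p \<omega> Y =
     (\<Sum>l\<in>UNIV. \<Sum>m\<in>UNIV. (\<beta> $ m + B_field chi m (x l) q p) * \<omega> (commutator (i_sigma m l) Y))"

definition fixed_point ::
  "(real \<Rightarrow> real) \<Rightarrow> ('n::finite \<Rightarrow> real^3) \<Rightarrow> real^3 \<Rightarrow> real
    \<Rightarrow> field3 \<Rightarrow> field3 \<Rightarrow> ('n spin_op \<Rightarrow> real) \<Rightarrow> bool" where
  "fixed_point chi x \<beta> h q p \<omega> \<longleftrightarrow>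
     q \<in> dom_M \<and> p \<in> dom_M \<and> \<omega> \<in> dual_G \<and>
     (AE k in lborel. rhs_q chi x h q p \<omega> k = 0) \<and>
     (AE k in lborel. rhs_p chi x h q p \<omega> k = 0) \<and>
     (\<forall>Y\<in>lie_G. rhs_omega chi x \<beta> q p \<omega> Y = 0)"

section \<open>The product states and the coupling constants\<close>

definition sigma_dot :: "real^3 \<Rightarrow> complex^2 \<Rightarrow> complex^2" where
  "sigma_dot \<beta> v = (\<Sum>m\<in>UNIV. complex_of_real (\<beta> $ m) *s (pauli m *v v))"

definition a_state :: "complex^2 \<Rightarrow> complex^2 \<Rightarrow> ('n::finite) set \<Rightarrow> 'n spin" where
  "a_state b0 b1 E = tensor_vec (\<lambda>l. if l \<in> E then b1 else b0)"

definition spin_sign :: "'n set \<Rightarrow> 'n \<Rightarrow> real" where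
  "spin_sign E l = (if l \<in> E then 1 else - 1)"

definition C33 :: "(real \<Rightarrow> real) \<Rightarrow> ('n \<Rightarrow> real^3) \<Rightarrow> 'n \<Rightarrow> 'n \<Rightarrow> real" where
  "C33 chi x l r = inverse ((2 * pi) ^ 3) *
     (LINT k|lborel. \<bar>chi (norm k)\<bar>\<^sup>2 * cos (k \<bullet> (x l - x r))
        * (((k $ 1)\<^sup>2 + (k $ 2)\<^sup>2) / (norm k)\<^sup>2))"

end

theory Submission
  imports Defs "HOL-Probability.Sinc_Integral"
begin

text \<open>In a product of eigenvectors of \<open>\<beta> \<cdot> \<sigma>\<close> every spin points along \<open>n = \<beta> / |\<beta>|\<close>, that is
  \<open>\<langle>\<pi>\<^sub>a, i\<sigma>\<^sub>m\<^sup>[\<^sup>\<lambda>\<^sup>]\<rangle> = \<epsilon>\<^sub>\<lambda> n\<^sub>m\<close>, because \<open>\<sigma>\<^sub>m\<close> and \<open>\<sigma>\<^sub>j\<close> anticommute for \<open>m \<noteq> j\<close>. The first two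
  fixed point equations then determine \<open>q\<close> and \<open>p\<close>. The magnetic field they generate at
  \<open>x\<^sub>\<lambda>\<close> is an integral that involves only \<open>k \<cdot> (x\<^sub>\<lambda> - x\<^sub>\<mu>)\<close>, so reflecting \<open>k\<close> in the plane
  orthogonal to \<open>\<beta>\<close> shows that this field is parallel to \<open>\<beta>\<close>. Hence each spin is an eigenvector of
  its total field, and the third equation holds. Since \<open>M q\<close> and \<open>M p\<close> are given by the
  sources, the field energy is minus one half of the interaction energy.\<close>

section \<open>Integrals over Euclidean space\<close>

text \<open>\<open>lborel\<close> is the image of a product of one-dimensional Lebesgue measures, so
  Fubini reduces the claim to the integrability of \<open>1 / (1 + t^2)\<close> on the line.\<close>

lemma integrable_prod_inverse_Basis:
  "integrable lborel (\<lambda>x::'a::euclidean_space. \<Prod>b\<in>Basis. inverse (1 + (x \<bullet> b)\<^sup>2))"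
proof -
  have "integrable lborel (\<lambda>x::real. inverse (1 + x\<^sup>2))"
    using integrable_inverse_1_plus_square by (simp add: set_integrable_def)
  then have "integrable (\<Pi>\<^sub>M b\<in>(Basis::'a set). interval_measure (\<lambda>x. x))
      (\<lambda>f. \<Prod>b\<in>Basis. inverse (1 + (f b)\<^sup>2))"
    unfolding lborel_eq_real[symmetric]
    by (intro product_sigma_finite.product_integrable_prod)
       (auto simp: product_sigma_finite_def lborel.sigma_finite_measure_axioms)
  also have "(\<lambda>f. \<Prod>b\<in>(Basis::'a set). inverse (1 + (f b)\<^sup>2))
      = (\<lambda>f. \<Prod>b\<in>Basis. inverse (1 + ((\<Sum>c\<in>Basis. f c *\<^sub>R c) \<bullet> b)\<^sup>2))"
    by (intro ext prod.cong) (auto simp: inner_sum_left inner_Basis if_distrib cong: if_cong)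
  finally show ?thesis
    unfolding lborel_def by (subst integrable_distr_eq) auto
qed

text \<open>Each coordinate is bounded by the norm, so the preceding product is a majorant. The case
  of dimension three controls the cutoff below.\<close>

lemma integrable_inverse_one_plus_norm_square:
  "integrable lborel (\<lambda>x::'a::euclidean_space. inverse ((1 + (norm x)\<^sup>2) ^ DIM('a)))"
proof (rule Bochner_Integration.integrable_bound[OF integrable_prod_inverse_Basis])
  have "(1 + (norm x)\<^sup>2) ^ DIM('a) \<ge> (\<Prod>b\<in>Basis. 1 + (x \<bullet> b)\<^sup>2)" for x :: 'a
  proof -
    have "(\<Prod>b\<in>Basis. 1 + (x \<bullet> b)\<^sup>2) \<le> (\<Prod>b\<in>(Basis::'a set). 1 + (norm x)\<^sup>2)"
      by (intro prod_mono) (auto simp: Basis_le_norm power2_le_iff_abs_le)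
    then show ?thesis by simp
  qed
  moreover have "0 < (\<Prod>b\<in>Basis. 1 + (x \<bullet> b)\<^sup>2)" for x :: 'a
    by (intro prod_pos) (auto simp: add_pos_nonneg)
  ultimately show "AE x::'a in lborel. norm (inverse ((1 + (norm x)\<^sup>2) ^ DIM('a)))
      \<le> norm (\<Prod>b\<in>Basis. inverse (1 + (x \<bullet> b)\<^sup>2))"
    by (simp add: prod_inversef[unfolded o_def] abs_prod le_imp_inverse_le less_imp_le)
qed auto

text \<open>For the integral I, substituting \<open>g k\<close> gives I = - |det g| I. Hence (1 +
  |det g|) I = 0, and the first factor is positive.\<close>

lemma lborel_integral_odd_involution:
  fixes g :: "real^'m::{finite,wellorder} \<Rightarrow> real^'m::_" and f :: "real^'m::_ \<Rightarrow> real"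
  assumes "linear g" and inv: "\<And>k. g (g k) = k" and odd: "\<And>k. f (g k) = - f k"
    and int: "integrable lborel f"
  shows "(LINT k|lborel. f k) = 0"
proof -
  \<comment> \<open>The change of variables formula is applied to a vector-valued map, so
    \<open>f\<close> is read as a map into \<open>real^1\<close>.\<close>
  define F :: "real^'m::_ \<Rightarrow> real^1" where "F k = f k *\<^sub>R 1" for k
  have surj: "range g = UNIV" using inv by (metis surjI)
  have intF: "integrable lborel F" unfolding F_def using int by simp
  then have "F absolutely_integrable_on UNIV"
    by (simp add: set_integrable_def integrable_completion)
  then have "integral (range g) F = \<bar>det (matrix g)\<bar> *\<^sub>R integral UNIV (F \<circ> g)"
    using integral_change_of_variables_linear[OF \<open>linear g\<close>, where f = F and S = UNIV] surj by simp
  moreover have "F \<circ> g = (\<lambda>k. - F k)" by (auto simp: F_def odd)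
  ultimately have "integral UNIV F = - \<bar>det (matrix g)\<bar> *\<^sub>R integral UNIV F"
    using surj by simp
  then have "(1 + \<bar>det (matrix g)\<bar>) *\<^sub>R integral UNIV F = 0"
    by (simp only: scaleR_left_distrib scaleR_one) (metis add.right_inverse minus_minus scaleR_minus_left)
  then have "integral UNIV F = 0"
    by (metis abs_ge_zero add_pos_nonneg less_irrefl scaleR_eq_0_iff zero_less_one)
  then have "(LINT k|lborel. F k) = 0" using integral_lborel[OF intF] by simp
  then show ?thesis
    unfolding F_def using int by (simp)
qed

section \<open>Product states\<close>

lemma hermitian_inner_sum_left:
  "hermitian_inner (\<Sum>i\<in>I. u i) v = (\<Sum>i\<in>I. hermitian_inner (u i) v)"
  by (simp add: hermitian_inner_def sum_distrib_right sum.swap[of _ _ I])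

lemma hermitian_inner_sum_right:
  "hermitian_inner u (\<Sum>i\<in>I. v i) = (\<Sum>i\<in>I. hermitian_inner u (v i))"
  by (simp add: hermitian_inner_def sum_distrib_left sum.swap[of _ _ I])

lemma hermitian_inner_add_left:
  "hermitian_inner (u + u') v = hermitian_inner u v + hermitian_inner u' v"
  by (simp add: hermitian_inner_def sum.distrib algebra_simps)

lemma hermitian_inner_diff_left:
  "hermitian_inner (u - u') v = hermitian_inner u v - hermitian_inner u' v"
  by (simp add: hermitian_inner_def sum_subtractf algebra_simps)

lemma hermitian_inner_minus_right: "hermitian_inner u (- v) = - hermitian_inner u v"
  by (simp add: hermitian_inner_def sum_negf)

lemma hermitian_inner_smult_left: "hermitian_inner (c *s u) v = c * hermitian_inner u v"
  by (simp add: hermitian_inner_def sum_distrib_left algebra_simps)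

lemma hermitian_inner_smult_right: "hermitian_inner u (c *s v) = cnj c * hermitian_inner u v"
  by (simp add: hermitian_inner_def sum_distrib_left algebra_simps)

lemma hermitian_inner_commute: "hermitian_inner v u = cnj (hermitian_inner u v)"
  by (simp add: hermitian_inner_def mult.commute)

lemma hermitian_inner_self: "hermitian_inner b b = complex_of_real ((norm b)\<^sup>2)"
  by (simp add: hermitian_inner_def norm_vec_def L2_set_def complex_norm_square[symmetric] 
      of_real_sum sum_nonneg)

lemma hermitian_inner_adj: "hermitian_inner (A *v u) v = hermitian_inner u (adj A *v v)"
  unfolding hermitian_inner_def adj_def map_matrix_def transpose_def matrix_vector_mult_def
  by (simp add: sum_distrib_left sum_distrib_right mult_ac)
     (subst sum.swap, simp add: mult_ac)

lemma uminus_matrix_vector_mult: "(- M) *v u = - (M *v u)" for M :: "'a::ring_1^'n^'m"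
  by (simp add: vec_eq_iff matrix_vector_mult_def sum_negf)

text \<open>Moving the outer factor across gives <ABa,a> = - <Ba,Aa> and <BAa,a> = - <Aa,Ba>. The
  difference is <Aa,Ba> minus its conjugate, hence 2i times an imaginary part.\<close>

lemma pure_state_commutator:
  assumes "adj A = - A" "adj B = - B"
  shows "pure_state a (commutator A B) = 2 * Im (hermitian_inner (A *v a) (B *v a))"
proof -
  have "hermitian_inner (commutator A B *v a) a
      = hermitian_inner (A *v (B *v a)) a - hermitian_inner (B *v (A *v a)) a"
    by (simp add: commutator_def matrix_vector_mult_diff_rdistrib matrix_vector_mul_assoc
        hermitian_inner_diff_left)
  also have "\<dots> = hermitian_inner (A *v a) (B *v a) - cnj (hermitian_inner (A *v a) (B *v a))"
    by (simp add: hermitian_inner_adj[of A "B *v a" a] hermitian_inner_adj[of B "A *v a" a] assms uminus_matrix_vector_mult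
        hermitian_inner_minus_right hermitian_inner_commute[of "B *v a"])
  finally show ?thesis by (simp add: pure_state_def)
qed

lemma pure_state_in_dual_G:
  fixes a :: "'n::finite spin"
  shows "pure_state a \<in> dual_G"
proof -
  have "(c *\<^sub>R X) *v a = complex_of_real c *s (X *v a)" for c and X :: "'n spin_op"
    by (simp add: vec_eq_iff matrix_vector_mult_def sum_distrib_left scaleR_conv_of_real[symmetric]
        scaleR_right.sum)
  then show ?thesis
    by (simp add: dual_G_def pure_state_def matrix_vector_mult_add_rdistrib
        hermitian_inner_add_left hermitian_inner_smult_left algebra_simps)
qed

text \<open>The coordinates run over all functions \<open>s\<close>, so distributivity turns the sum
  of products into a product of sums over single factors.\<close>

lemma hermitian_inner_tensor_vec:
  fixes v w :: "'n::finite \<Rightarrow> complex^2"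
  shows "hermitian_inner (tensor_vec v) (tensor_vec w) = (\<Prod>l\<in>UNIV. hermitian_inner (v l) (w l))"
  using prod_sum_PiE[of "UNIV :: 'n set" "\<lambda>_. UNIV :: 2 set" "\<lambda>l j. v l $ j * cnj (w l $ j)"]
  by (simp add: hermitian_inner_def tensor_vec_def prod.distrib)

text \<open>Isolates the factor at \<open>l\<close>, which makes the linear dependence on
  \<open>w\<close> visible.\<close>

lemma tensor_vec_fun_upd:
  "tensor_vec (v(l := w)) $ s = w $ s l * (\<Prod>r\<in>UNIV - {l}. v r $ s r)"
proof -
  have "(\<Prod>r\<in>UNIV - {l}. (v(l := w)) r $ s r) = (\<Prod>r\<in>UNIV - {l}. v r $ s r)"
    by (intro prod.cong) auto
  then show ?thesis
    by (simp add: tensor_vec_def prod.remove[of UNIV l])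
qed

lemma i_sigma_tensor_vec:
  "i_sigma m l *v tensor_vec v = \<i> *s tensor_vec (v(l := pauli m *v v l))"
proof -
  have "i_sigma m l *v u = \<i> *s (on_factor l (pauli m) *v u)" for u
    by (simp add: i_sigma_def vec_eq_iff matrix_vector_mult_def map_matrix_def sum_distrib_left
        mult.assoc)
  moreover have "(\<lambda>r. (if r = l then pauli m else mat 1) *v v r) = v(l := pauli m *v v l)"
    by auto
  ultimately show ?thesis by (simp add: on_factor_def tensor_op_tensor_vec)
qed

section \<open>Pauli matrices and expectations in products of their eigenvectors\<close>

lemma pauli_simps:
  "pauli 1 = vector [vector [0, 1], vector [1, 0]]"
  "pauli 2 = vector [vector [0, - \<i>], vector [\<i>, 0]]"
  "pauli 3 = vector [vector [1, 0], vector [0, - 1]]"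
  by (simp_all add: pauli_def)

lemma cnj_pauli: "cnj (pauli m $ i $ j) = pauli m $ j $ i"
  using exhaust_3[of m] exhaust_2[of i] exhaust_2[of j] by (auto simp: pauli_simps)

lemma adj_i_sigma: "adj (i_sigma m l) = - i_sigma m l"
  unfolding i_sigma_def on_factor_def tensor_op_def adj_def map_matrix_def transpose_def
  by (simp add: vec_eq_iff cnj_prod cnj_pauli mat_def if_distrib[of cnj] if_distribR)
     (auto intro!: prod.cong simp: cnj_pauli mat_def)

text \<open>For \<open>m \<noteq> j\<close> anticommutation makes the inner product equal to minus
  its conjugate; for \<open>m = j\<close> it is the squared norm because Pauli matrices are unitary.
  The proof checks all cases in coordinates.\<close>

lemma Re_hermitian_inner_pauli:
  "Re (hermitian_inner (pauli m *v b) (pauli j *v b)) = (if m = j then (norm b)\<^sup>2 else 0)"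
proof -
  have "(norm b)\<^sup>2 = (Re (b$1))\<^sup>2 + (Im (b$1))\<^sup>2 + (Re (b$2))\<^sup>2 + (Im (b$2))\<^sup>2"
    by (simp add: norm_vec_def L2_set_def UNIV_2 cmod_power2)
  then show ?thesis
    using exhaust_3[of m] exhaust_3[of j]
    by (auto simp: pauli_simps hermitian_inner_def sum_2 matrix_vector_mult_def power2_eq_square
        algebra_simps)
qed

text \<open>Pair the eigenvalue equation with \<open>pauli m *v b\<close>: by the orthogonality
  above only the term \<open>j = m\<close> of \<open>sigma_dot\<close> survives.\<close>

lemma Re_hermitian_inner_pauli_eigenvector:
  assumes "norm b = 1" and "sigma_dot \<beta> b = complex_of_real c *s b"
  shows "c * Re (hermitian_inner (pauli m *v b) b) = \<beta> $ m"
proof -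
  have "c * Re (hermitian_inner (pauli m *v b) b)
      = Re (hermitian_inner (pauli m *v b) (sigma_dot \<beta> b))"
    by (simp add: assms hermitian_inner_smult_right)
  also have "\<dots> = (\<Sum>j\<in>UNIV. \<beta> $ j * Re (hermitian_inner (pauli m *v b) (pauli j *v b)))"
    by (simp add: sigma_dot_def hermitian_inner_sum_right hermitian_inner_smult_right)
  also have "\<dots> = \<beta> $ m"
    by (simp add: Re_hermitian_inner_pauli assms if_distrib cong: if_cong)
  finally show ?thesis .
qed

text \<open>Every factor other than \<open>l\<close> contributes its squared norm 1, which leaves
  the expectation in the single factor \<open>l\<close>.\<close>

lemma pure_state_i_sigma:
  assumes "\<And>l. norm (v l) = 1" and "sigma_dot \<beta> (v l) = complex_of_real c *s v l"
  shows "c * pure_state (tensor_vec v) (i_sigma m l) = \<beta> $ m"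
proof -
  have "(\<Prod>r\<in>UNIV. hermitian_inner ((v(l := pauli m *v v l)) r) (v r))
      = hermitian_inner (pauli m *v v l) (v l)"
    by (subst prod.remove[of UNIV l]) (auto intro!: prod.neutral simp: hermitian_inner_self assms)
  then have "pure_state (tensor_vec v) (i_sigma m l) = Re (hermitian_inner (pauli m *v v l) (v l))"
    by (simp add: pure_state_def i_sigma_tensor_vec hermitian_inner_smult_left
        hermitian_inner_tensor_vec)
  then show ?thesis using assms Re_hermitian_inner_pauli_eigenvector by simp
qed

lemma sum_i_sigma_tensor_vec:
  assumes "sigma_dot \<beta> (v l) = complex_of_real c *s v l"
  shows "(\<Sum>m\<in>UNIV. complex_of_real (\<beta> $ m) *s (i_sigma m l *v tensor_vec v))
    = (\<i> * complex_of_real c) *s tensor_vec v"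
proof (subst vec_eq_iff, intro allI)
  fix s
  let ?P = "\<Prod>r\<in>UNIV - {l}. v r $ s r"
  have "(\<Sum>m\<in>UNIV. complex_of_real (\<beta> $ m) *s (i_sigma m l *v tensor_vec v)) $ s
      = \<i> * (sigma_dot \<beta> (v l) $ s l * ?P)"
    by (simp add: i_sigma_tensor_vec tensor_vec_fun_upd sigma_dot_def sum_distrib_left
        sum_distrib_right mult_ac)
  \<comment> \<open>\<open>v(l := v l)\<close> is \<open>v\<close> itself; written as an update, it
    exposes the factor at \<open>l\<close> on this side too.\<close>
  also have "\<dots> = \<i> * (c * tensor_vec (v(l := v l)) $ s)"
    unfolding tensor_vec_fun_upd assms by simp
  finally show "(\<Sum>m\<in>UNIV. complex_of_real (\<beta> $ m) *s (i_sigma m l *v tensor_vec v)) $ s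
      = ((\<i> * complex_of_real c) *s tensor_vec v) $ s"
    by simp
qed

text \<open>A spin that is an eigenvector of its field does not precess. With a the product vector,
  the sum is 2 Im <i c a, Y a> = 2 c Re <a, Y a>, and antihermiticity of \<open>Y\<close> makes <a,
  Y a> imaginary.\<close>

lemma sum_pure_state_commutator_eq_0:
  assumes "sigma_dot \<beta> (v l) = complex_of_real c *s v l" and "Y \<in> lie_G"
  shows "(\<Sum>m\<in>UNIV. \<beta> $ m * pure_state (tensor_vec v) (commutator (i_sigma m l) Y)) = 0"
proof -
  let ?a = "tensor_vec v"
  have Y: "adj Y = - Y" using assms by (simp add: lie_G_def)
  have "(\<Sum>m\<in>UNIV. \<beta> $ m * pure_state ?a (commutator (i_sigma m l) Y))
    = 2 * Im (hermitian_inner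
        (\<Sum>m\<in>UNIV. complex_of_real (\<beta> $ m) *s (i_sigma m l *v ?a)) (Y *v ?a))"
    by (simp add: pure_state_commutator adj_i_sigma Y hermitian_inner_sum_left
        hermitian_inner_smult_left sum_distrib_left mult_ac)
  also have "\<dots> = 2 * c * Re (hermitian_inner ?a (Y *v ?a))"
    by (simp add: sum_i_sigma_tensor_vec[of \<beta> v l, OF assms(1)] hermitian_inner_smult_left)
  also have "Re (hermitian_inner ?a (Y *v ?a)) = 0"
  proof -
    have "hermitian_inner ?a (Y *v ?a) = - cnj (hermitian_inner ?a (Y *v ?a))"
      by (subst hermitian_inner_commute)
         (simp add: hermitian_inner_adj Y uminus_matrix_vector_mult hermitian_inner_minus_right)
    then have "Re (hermitian_inner ?a (Y *v ?a)) = - Re (hermitian_inner ?a (Y *v ?a))"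
      by (metis complex_cnj_minus cnj.sel(1) uminus_complex.sel(1))
    then show ?thesis by simp
  qed
  finally show ?thesis by simp
qed

section \<open>Schwartz cutoffs and transverse fields\<close>

lemma schwartz_continuous:
  assumes "schwartz chi"
  shows "continuous_on UNIV chi"
proof -
  have "(deriv ^^ 0) chi field_differentiable (at t)" for t
    using assms unfolding schwartz_def by blast
  then show ?thesis
    by (intro continuous_at_imp_continuous_on ballI field_differentiable_imp_continuous_at) simp
qed

lemma schwartz_power_bound:
  assumes "schwartz chi"
  obtains C where "\<And>t. \<bar>chi t\<bar> * (1 + t\<^sup>2) ^ 2 \<le> C"
proof -
  have "\<exists>C. \<forall>t. \<bar>t ^ m * chi t\<bar> \<le> C" for m
  proof -
    have "bounded (range (\<lambda>t. t ^ m * (deriv ^^ 0) chi t))"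
      using assms unfolding schwartz_def by blast
    then show ?thesis by (auto simp: bounded_iff)
  qed
  then obtain C where C: "\<And>m t. \<bar>t ^ m * chi t\<bar> \<le> C m" by metis
  have "\<bar>chi t\<bar> * (1 + t\<^sup>2) ^ 2 \<le> C 0 + 2 * C 2 + C 4" for t
  proof -
    have "(1 + t\<^sup>2) ^ 2 = 1 + 2 * t ^ 2 + t ^ 4"
      by (simp add: power2_sum)
    then have "\<bar>chi t\<bar> * (1 + t\<^sup>2) ^ 2 = \<bar>t ^ 0 * chi t\<bar> + 2 * \<bar>t ^ 2 * chi t\<bar> + \<bar>t ^ 4 * chi t\<bar>"
      by (simp add: abs_mult distrib_left)
    with C[of t 0] C[of t 2] C[of t 4] show ?thesis by linarith
  qed
  then show ?thesis by (rule that)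
qed

text \<open>The terms 1/|k| and |k| of the weight serve for a static field and for its image under
  \<open>Mop\<close>. The weight equals (1 + t^2)/t, and 1/t is at most 1/d where \<open>chi\<close>
  can be nonzero; four powers of 1 + t^2 are gained from the square of \<open>chi\<close>, one is
  spent on the weight, and three remain for integrability.\<close>

lemma schwartz_radial_integrable:
  assumes "schwartz chi" and "vanishes_near_zero chi"
  shows "integrable lborel (\<lambda>k::real^3. (chi (norm k))\<^sup>2 * (inverse (norm k) + norm k))"
proof -
  obtain C where C: "\<And>t. \<bar>chi t\<bar> * (1 + t\<^sup>2) ^ 2 \<le> C"
    using schwartz_power_bound[OF assms(1)] by blast
  obtain d where d: "d > 0" "\<And>t. \<bar>t\<bar> < d \<Longrightarrow> chi t = 0"
    using assms(2) by (auto simp: vanishes_near_zero_def eventually_nhds_metric)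
  have [measurable]: "chi \<in> borel_measurable borel"
    using schwartz_continuous[OF assms(1)] by (rule borel_measurable_continuous_onI)
  have bound: "(chi t)\<^sup>2 * (inverse t + t) \<le> C\<^sup>2 / d * inverse ((1 + t\<^sup>2) ^ 3)" if "t \<ge> 0" for t
  proof (cases "t < d")
    case True
    then show ?thesis using d that by simp
  next
    case False
    then have t: "t > 0" "d \<le> t" using d by auto
    have pos: "1 + t\<^sup>2 > 0" by (simp add: add_pos_nonneg)
    have "(chi t)\<^sup>2 * (1 + t\<^sup>2) ^ 4 = (\<bar>chi t\<bar> * (1 + t\<^sup>2) ^ 2)\<^sup>2"
      by (simp add: power_mult_distrib flip: power_mult)
    also have "\<dots> \<le> C\<^sup>2" by (intro power_mono C) simp
    finally have "(chi t)\<^sup>2 * (1 + t\<^sup>2) ^ 4 \<le> C\<^sup>2" .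
    then have "(chi t)\<^sup>2 * (1 + t\<^sup>2) \<le> C\<^sup>2 * inverse ((1 + t\<^sup>2) ^ 3)"
      using pos power_add[of "1 + t\<^sup>2" 1 3] by (simp add: pos_le_divide_eq mult.assoc flip: divide_inverse)
    then have "(chi t)\<^sup>2 * (1 + t\<^sup>2) / t \<le> C\<^sup>2 * inverse ((1 + t\<^sup>2) ^ 3) / d"
      using t d(1) pos by (intro frac_le) auto
    moreover have "inverse t + t = (1 + t\<^sup>2) / t"
      using t by (simp add: field_simps power2_eq_square)
    ultimately show ?thesis by simp
  qed
  show ?thesis
  proof (rule Bochner_Integration.integrable_bound)
    show "integrable lborel (\<lambda>k::real^3. C\<^sup>2 / d * inverse ((1 + (norm k)\<^sup>2) ^ 3))"
      using integrable_inverse_one_plus_norm_square[where 'a="real^3"] by simp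
    show "AE k::real^3 in lborel. norm ((chi (norm k))\<^sup>2 * (inverse (norm k) + norm k))
        \<le> norm (C\<^sup>2 / d * inverse ((1 + (norm k)\<^sup>2) ^ 3))"
    proof (rule AE_I2)
      fix k :: "real^3"
      have "norm ((chi (norm k))\<^sup>2 * (inverse (norm k) + norm k))
          = (chi (norm k))\<^sup>2 * (inverse (norm k) + norm k)" by simp
      also have "\<dots> \<le> C\<^sup>2 / d * inverse ((1 + (norm k)\<^sup>2) ^ 3)" by (rule bound) simp
      also have "\<dots> \<le> norm \<dots>" unfolding real_norm_def by (rule abs_ge_self)
      finally show "norm ((chi (norm k))\<^sup>2 * (inverse (norm k) + norm k))
        \<le> norm (C\<^sup>2 / d * inverse ((1 + (norm k)\<^sup>2) ^ 3))" .
    qed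
  qed measurable
qed

lemma schwartz_weight_bound:
  assumes "vanishes_near_zero chi" and "t \<ge> 0"
  shows "(chi t)\<^sup>2 \<le> (chi t)\<^sup>2 * (inverse t + t)"
proof (cases "t = 0")
  \<comment> \<open>Here \<open>inverse 0 = 0\<close> makes the weight vanish, so the bound rests on
    \<open>chi 0 = 0\<close>.\<close>
  case True
  have "chi 0 = 0"
    using assms(1) unfolding vanishes_near_zero_def by (rule eventually_nhds_x_imp_x)
  then show ?thesis using True by simp
next
  case False
  then have "t > 0" using assms by simp
  moreover have "0 \<le> (t - 1)\<^sup>2" by simp
  ultimately have "1 \<le> inverse t + t"
    by (simp add: field_simps power2_eq_square)
  then show ?thesis by (simp add: mult_le_cancel_left1)
qed

section \<open>Inner products and cross product fields in the Hilbert space\<close>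

lemma borel_measurable_vec_nth' [measurable (raw)]:
  fixes f :: "'a \<Rightarrow> real^'n"
  assumes "f \<in> borel_measurable M"
  shows "(\<lambda>z. f z $ j) \<in> borel_measurable M"
  by (rule borel_measurable_continuous_on[OF _ assms]) (intro continuous_intros)

lemma Hspace_inner:
  assumes "f \<in> Hspace" "g \<in> Hspace"
  shows "integrable lborel (\<lambda>k. f k \<bullet> g k)" and "Hinner f g = (LINT k|lborel. f k \<bullet> g k)"
proof -
  have [measurable]: "f \<in> borel_measurable borel" "g \<in> borel_measurable borel"
    using assms by (auto simp: Hspace_def)
  have int: "integrable lborel (\<lambda>k. f k $ j * g k $ j)" for j
  proof (rule Bochner_Integration.integrable_bound)
    show "integrable lborel (\<lambda>k. (f k $ j)\<^sup>2 + (g k $ j)\<^sup>2)"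
      using assms by (auto simp: Hspace_def)
    have "\<bar>u * v\<bar> \<le> u\<^sup>2 + v\<^sup>2" for u v :: real
      using sum_squares_bound[of "\<bar>u\<bar>" "\<bar>v\<bar>"] abs_ge_zero[of "u * v"]
      unfolding abs_mult power2_abs by linarith
    then show "AE k in lborel. norm (f k $ j * g k $ j) \<le> norm ((f k $ j)\<^sup>2 + (g k $ j)\<^sup>2)"
      by simp
  qed measurable
  show "integrable lborel (\<lambda>k. f k \<bullet> g k)"
    unfolding inner_vec_def using int by simp
  show "Hinner f g = (LINT k|lborel. f k \<bullet> g k)"
    unfolding inner_vec_def Hinner_def using int by simp
qed

text \<open>A cross product with \<open>k\<close> is orthogonal to \<open>k\<close>, and its norm is
  at most |k| |v|.\<close>

lemma cross_field_in_Hspace: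
  assumes [measurable]: "g \<in> borel_measurable borel"
    and int: "integrable lborel (\<lambda>k. (g k)\<^sup>2 * (norm k)\<^sup>2)"
  shows "(\<lambda>k. g k *\<^sub>R cross3 k v) \<in> Hspace"
proof -
  have [measurable]: "(\<lambda>k. cross3 k v) \<in> borel_measurable borel"
    by (intro borel_measurable_continuous_onI continuous_on_cross continuous_intros)
  have "integrable lborel (\<lambda>k. ((g k *\<^sub>R cross3 k v) $ j)\<^sup>2)" for j
  proof (rule Bochner_Integration.integrable_bound)
    show "integrable lborel (\<lambda>k. (norm v)\<^sup>2 * ((g k)\<^sup>2 * (norm k)\<^sup>2))"
      using int by simp
    have "((g k *\<^sub>R cross3 k v) $ j)\<^sup>2 \<le> (norm v)\<^sup>2 * ((g k)\<^sup>2 * (norm k)\<^sup>2)" for k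
    proof -
      have "((g k *\<^sub>R cross3 k v) $ j)\<^sup>2 \<le> (norm (g k *\<^sub>R cross3 k v))\<^sup>2"
        using component_le_norm_cart[of "g k *\<^sub>R cross3 k v" j]
        by (simp only: abs_le_square_iff[symmetric] abs_norm_cancel)
      also have "\<dots> = (g k)\<^sup>2 * (norm (cross3 k v))\<^sup>2" by (simp add: power_mult_distrib)
      also have "\<dots> \<le> (g k)\<^sup>2 * ((norm k)\<^sup>2 * (norm v)\<^sup>2)"
        by (intro mult_left_mono) (simp_all add: norm_cross)
      finally show ?thesis by (simp add: mult_ac)
    qed
    then show "AE k in lborel. norm (((g k *\<^sub>R cross3 k v) $ j)\<^sup>2)
        \<le> norm ((norm v)\<^sup>2 * ((g k)\<^sup>2 * (norm k)\<^sup>2))"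
      by (simp)
  qed measurable
  moreover have "(\<lambda>k. g k *\<^sub>R cross3 k v) \<in> borel_measurable lborel" by measurable
  ultimately show ?thesis by (simp add: Hspace_def dot_cross_self)
qed

section \<open>The static field of aligned spins\<close>

definition radial :: "(real \<Rightarrow> real) \<Rightarrow> real^3 \<Rightarrow> real" where
  "radial chi k = chi (norm k) * sqrt (norm k) / (2 * pi) powr (3/2) / norm k"

text \<open>Taking \<open>trig\<close> to be \<open>sin\<close> or \<open>cos\<close> lets one
  argument serve both families of modes.\<close>

definition mode_field :: "(real \<Rightarrow> real) \<Rightarrow> (real \<Rightarrow> real) \<Rightarrow> 3 \<Rightarrow> real^3 \<Rightarrow> field3" where
  "mode_field chi trig m y = (\<lambda>k. (radial chi k * trig (k \<bullet> y)) *\<^sub>R cross3 k (axis m 1))"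

lemma a_field_mode: "a_field chi m y = mode_field chi sin m y"
  and b_field_mode: "b_field chi m y = mode_field chi cos m y"
  by (auto simp: a_field_def b_field_def mode_field_def radial_def)

lemma sum_cross3_axis: "(\<Sum>m\<in>UNIV. n $ m *\<^sub>R cross3 k (axis m 1)) = cross3 k n"
  by (simp add: vec_eq_iff sum_3 forall_3 cross3_def axis_def)

lemma radial_square: "(radial chi k)\<^sup>2 * norm k = (chi (norm k))\<^sup>2 / (2 * pi) ^ 3" if "k \<noteq> 0"
proof -
  have "((2 * pi) powr (3/2))\<^sup>2 = (2 * pi) powr 3"
    by (simp add: powr_power)
  also have "\<dots> = (2 * pi) ^ 3" by simp
  finally have "(radial chi k)\<^sup>2 * norm k
      = (chi (norm k))\<^sup>2 * norm k / (2 * pi) ^ 3 / (norm k)\<^sup>2 * norm k"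
    unfolding radial_def by (simp only: power_divide power_mult_distrib real_sqrt_pow2 norm_ge_zero)
  then show ?thesis using that by (simp add: power2_eq_square)
qed

text \<open>The field problem separated from the spin algebra: the spins enter only as real weights
  \<open>\<epsilon>\<close> along a common unit vector \<open>n\<close>.\<close>

locale aligned_spins =
  fixes chi :: "real \<Rightarrow> real" and x :: "'n::finite \<Rightarrow> real^3" and n :: "real^3"
    and \<epsilon> :: "'n \<Rightarrow> real" and h :: real
  assumes schwartz_chi: "schwartz chi" and vanishes_chi: "vanishes_near_zero chi"
    and norm_n: "norm n = 1" and coplanar: "n \<bullet> (x l - x r) = 0"
begin

lemma chi_0: "chi 0 = 0"
  using vanishes_chi unfolding vanishes_near_zero_def by (rule eventually_nhds_x_imp_x)

lemma chi_measurable [measurable]: "chi \<in> borel_measurable borel"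
  using schwartz_continuous[OF schwartz_chi] by (rule borel_measurable_continuous_onI)

lemma radial_measurable [measurable]: "radial chi \<in> borel_measurable borel"
  unfolding radial_def by measurable

lemma integrable_chi_square_bounded:
  assumes [measurable]: "s \<in> borel_measurable borel" and "\<And>k. \<bar>s k\<bar> \<le> M"
  shows "integrable lborel (\<lambda>k::real^3. (chi (norm k))\<^sup>2 * s k)"
proof (rule Bochner_Integration.integrable_bound)
  show "integrable lborel (\<lambda>k::real^3. M * ((chi (norm k))\<^sup>2 * (inverse (norm k) + norm k)))"
    using schwartz_radial_integrable[OF schwartz_chi vanishes_chi] by simp
  have "norm ((chi (norm k))\<^sup>2 * s k)
      \<le> norm (M * ((chi (norm k))\<^sup>2 * (inverse (norm k) + norm k)))" for k :: "real^3"
  proof -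
    have "norm ((chi (norm k))\<^sup>2 * s k) = \<bar>s k\<bar> * (chi (norm k))\<^sup>2" by (simp add: abs_mult)
    also have "\<dots> \<le> M * ((chi (norm k))\<^sup>2 * (inverse (norm k) + norm k))"
      using assms(2)[of k] schwartz_weight_bound[OF vanishes_chi, of "norm k"]
      by (intro mult_mono) auto
    finally show ?thesis by simp
  qed
  then show "AE k::real^3 in lborel. norm ((chi (norm k))\<^sup>2 * s k)
      \<le> norm (M * ((chi (norm k))\<^sup>2 * (inverse (norm k) + norm k)))" by simp
qed measurable

text \<open>The second field is the first divided by |k|, so the pair yields membership in
  \<open>dom_M\<close>. The two squared profiles are estimated together because their sum carries
  exactly the weight 1/|k| + |k|.\<close>

lemma radial_cross_field_in_Hspace:
  assumes [measurable]: "s \<in> borel_measurable borel" and M: "\<And>k. \<bar>s k\<bar> \<le> M"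
  shows "(\<lambda>k. (radial chi k * s k) *\<^sub>R cross3 k v) \<in> Hspace"
    and "(\<lambda>k. (radial chi k * s k / norm k) *\<^sub>R cross3 k v) \<in> Hspace"
proof -
  let ?w = "\<lambda>k::real^3. M\<^sup>2 / (2 * pi) ^ 3 * ((chi (norm k))\<^sup>2 * (inverse (norm k) + norm k))"
  have w: "integrable lborel ?w"
    using schwartz_radial_integrable[OF schwartz_chi vanishes_chi] by simp
  have s: "(s k)\<^sup>2 \<le> M\<^sup>2" for k using power_mono[OF M[of k], of 2] by simp
  have bound: "(radial chi k * s k)\<^sup>2 * (norm k)\<^sup>2 + (radial chi k * s k / norm k)\<^sup>2 * (norm k)\<^sup>2 \<le> ?w k"
    for k :: "real^3"
  proof (cases "k = 0")
    case True
    then show ?thesis by (simp add: chi_0)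
  next
    case False
    let ?R = "(chi (norm k))\<^sup>2 / (2 * pi) ^ 3 * (inverse (norm k) + norm k)"
    have "(radial chi k * s k)\<^sup>2 * (norm k)\<^sup>2 + (radial chi k * s k / norm k)\<^sup>2 * (norm k)\<^sup>2
        = (s k)\<^sup>2 * (((radial chi k)\<^sup>2 * norm k) * (inverse (norm k) + norm k))"
    proof -
      have "(r * s)\<^sup>2 * t\<^sup>2 + (r * s / t)\<^sup>2 * t\<^sup>2 = s\<^sup>2 * ((r\<^sup>2 * t) * (inverse t + t))"
        if "t \<noteq> 0" for r s t :: real
      proof -
        have "(r * s / t)\<^sup>2 * t\<^sup>2 = s\<^sup>2 * r\<^sup>2"
          using that by (simp add: power_divide power_mult_distrib)
        moreover have "(r\<^sup>2 * t) * (inverse t + t) = r\<^sup>2 + r\<^sup>2 * t\<^sup>2"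
          using that by (simp add: distrib_left power2_eq_square mult.assoc)
        ultimately show ?thesis by (simp add: power_mult_distrib distrib_left mult_ac)
      qed
      then show ?thesis using False by simp
    qed
    also have "\<dots> = (s k)\<^sup>2 * ?R" by (simp only: radial_square[OF False])
    also have "\<dots> \<le> M\<^sup>2 * ?R"
      by (intro mult_right_mono s) simp
    finally show ?thesis by simp
  qed
  show "(\<lambda>k. (radial chi k * s k) *\<^sub>R cross3 k v) \<in> Hspace"
  proof (rule cross_field_in_Hspace)
    show "integrable lborel (\<lambda>k. (radial chi k * s k)\<^sup>2 * (norm k)\<^sup>2)"
    proof (rule Bochner_Integration.integrable_bound[OF w])
      show "AE k in lborel. norm ((radial chi k * s k)\<^sup>2 * (norm k)\<^sup>2) \<le> norm (?w k)"
      proof (rule AE_I2)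
        fix k :: "real^3"
        have "0 \<le> (radial chi k * s k / norm k)\<^sup>2 * (norm k)\<^sup>2"
          "0 \<le> (radial chi k * s k)\<^sup>2 * (norm k)\<^sup>2" by simp_all
        with bound[of k] show "norm ((radial chi k * s k)\<^sup>2 * (norm k)\<^sup>2) \<le> norm (?w k)"
          unfolding real_norm_def by linarith
      qed
    qed measurable
  qed measurable
  show "(\<lambda>k. (radial chi k * s k / norm k) *\<^sub>R cross3 k v) \<in> Hspace"
  proof (rule cross_field_in_Hspace)
    show "integrable lborel (\<lambda>k. (radial chi k * s k / norm k)\<^sup>2 * (norm k)\<^sup>2)"
    proof (rule Bochner_Integration.integrable_bound[OF w])
      show "AE k in lborel. norm ((radial chi k * s k / norm k)\<^sup>2 * (norm k)\<^sup>2) \<le> norm (?w k)"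
      proof (rule AE_I2)
        fix k :: "real^3"
        have "0 \<le> (radial chi k * s k / norm k)\<^sup>2 * (norm k)\<^sup>2"
          "0 \<le> (radial chi k * s k)\<^sup>2 * (norm k)\<^sup>2" by simp_all
        with bound[of k] show "norm ((radial chi k * s k / norm k)\<^sup>2 * (norm k)\<^sup>2) \<le> norm (?w k)"
          unfolding real_norm_def by linarith
      qed
    qed measurable
  qed measurable
qed

definition phase_sum :: "(real \<Rightarrow> real) \<Rightarrow> real^3 \<Rightarrow> real" where
  "phase_sum trig k = (\<Sum>l\<in>UNIV. \<epsilon> l * trig (k \<bullet> x l))"

text \<open>The solution of the first two fixed point equations, obtained by dividing the sources by
  |k|: \<open>sin\<close> gives q and \<open>cos\<close> gives p.\<close>

definition static_field :: "(real \<Rightarrow> real) \<Rightarrow> field3" where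
  "static_field trig = (\<lambda>k. (radial chi k * (- h * phase_sum trig k) / norm k) *\<^sub>R cross3 k n)"

lemma Mop_static_field:
  "Mop (static_field trig) = (\<lambda>k. (radial chi k * (- h * phase_sum trig k)) *\<^sub>R cross3 k n)"
proof
  show "Mop (static_field trig) k = (radial chi k * (- h * phase_sum trig k)) *\<^sub>R cross3 k n" for k
    by (cases "k = 0") (simp_all add: Mop_def static_field_def)
qed

text \<open>The cross product is linear, so \<open>cross3 k n\<close> splits into the modes weighted
  by the components of \<open>n\<close>. This form gives stationarity and also the field
  energy.\<close>

lemma Mop_static_field_eq_sum:
  "Mop (static_field trig) k
    = - h *\<^sub>R (\<Sum>l\<in>UNIV. \<Sum>m\<in>UNIV. (\<epsilon> l * n $ m) *\<^sub>R mode_field chi trig m (x l) k)"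
proof -
  have "(\<Sum>m\<in>UNIV. (\<epsilon> l * n $ m) *\<^sub>R mode_field chi trig m (x l) k)
      = (radial chi k * (\<epsilon> l * trig (k \<bullet> x l))) *\<^sub>R cross3 k n" for l
    unfolding sum_cross3_axis[of n k, symmetric] scaleR_sum_right mode_field_def
    by (simp add: mult_ac)
  then show ?thesis
    by (simp add: Mop_static_field phase_sum_def scaleR_sum_left[symmetric] sum_distrib_left mult_ac)
qed

lemma static_field_in_dom_M:
  assumes "trig \<in> borel_measurable borel" and "\<And>t. \<bar>trig t\<bar> \<le> 1"
  shows "static_field trig \<in> dom_M"
proof -
  note assms(1) [measurable]
  have meas: "(\<lambda>k. - h * phase_sum trig k) \<in> borel_measurable borel"
    unfolding phase_sum_def by measurable
  have bound: "\<bar>- h * phase_sum trig k\<bar> \<le> \<bar>h\<bar> * (\<Sum>l\<in>UNIV. \<bar>\<epsilon> l\<bar>)" for k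
  proof -
    have "\<bar>phase_sum trig k\<bar> \<le> (\<Sum>l\<in>UNIV. \<bar>\<epsilon> l * trig (k \<bullet> x l)\<bar>)"
      unfolding phase_sum_def by (rule sum_abs)
    also have "\<dots> \<le> (\<Sum>l\<in>UNIV. \<bar>\<epsilon> l\<bar>)"
      by (intro sum_mono) (simp add: abs_mult mult_left_le assms)
    finally show ?thesis by (simp add: abs_mult mult_left_mono)
  qed
  show ?thesis
    unfolding dom_M_def mem_Collect_eq Mop_static_field
    unfolding static_field_def
    by (intro conjI radial_cross_field_in_Hspace meas) (rule bound)+
qed

lemma mode_field_in_Hspace:
  assumes [measurable]: "trig \<in> borel_measurable borel" and "\<And>t. \<bar>trig t\<bar> \<le> 1"
  shows "mode_field chi trig m y \<in> Hspace"
  unfolding mode_field_def by (rule radial_cross_field_in_Hspace) (measurable, rule assms)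

abbreviation q_static :: field3 where "q_static \<equiv> static_field sin"
abbreviation p_static :: field3 where "p_static \<equiv> static_field cos"

lemma static_in_dom_M: "q_static \<in> dom_M" "p_static \<in> dom_M"
  by (auto intro!: static_field_in_dom_M)

lemma static_in_Hspace: "q_static \<in> Hspace" "p_static \<in> Hspace"
  using static_in_dom_M by (auto simp: dom_M_def)

lemma modes_in_Hspace: "a_field chi m y \<in> Hspace" "b_field chi m y \<in> Hspace"
  by (auto simp: a_field_mode b_field_mode intro!: mode_field_in_Hspace)

section \<open>The magnetic field generated by the static field\<close>

definition kernel :: "'n \<Rightarrow> real^3 \<Rightarrow> real" where
  "kernel l k = - h / (2 * pi) ^ 3 * (\<Sum>r\<in>UNIV. \<epsilon> r * cos (k \<bullet> (x l - x r)))"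

text \<open>The addition theorem for the cosine combines both terms into phases of
  \<open>x l - x r\<close>, collected in \<open>kernel\<close>. The product of the two cross
  products is |k|^2 times the transverse projection of \<open>n\<close>, component
  \<open>m\<close>.\<close>

lemma B_integrand:
  "a_field chi m (x l) k \<bullet> q_static k + b_field chi m (x l) k \<bullet> p_static k
    = (chi (norm k))\<^sup>2 * (kernel l k * (n $ m - k $ m * (k \<bullet> n) / (norm k)\<^sup>2))"
proof (cases "k = 0")
  case True
  then show ?thesis by (simp add: chi_0 static_field_def)
next
  case False
  let ?s = "sin (k \<bullet> x l) * phase_sum sin k + cos (k \<bullet> x l) * phase_sum cos k"
  have s: "?s = (\<Sum>r\<in>UNIV. \<epsilon> r * cos (k \<bullet> (x l - x r)))"
    unfolding phase_sum_def sum_distrib_left sum.distrib[symmetric]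
    by (intro sum.cong refl) (simp add: inner_diff_right cos_diff algebra_simps)
  have c: "cross3 k (axis m 1) \<bullet> cross3 k n = (norm k)\<^sup>2 * (n $ m - k $ m * (k \<bullet> n) / (norm k)\<^sup>2)"
    using False
    by (simp add: dot_cross inner_axis' right_diff_distrib dot_square_norm mult.commute)
  have "a_field chi m (x l) k \<bullet> q_static k + b_field chi m (x l) k \<bullet> p_static k
    = - h * ?s * ((radial chi k)\<^sup>2 / norm k) * (cross3 k (axis m 1) \<bullet> cross3 k n)"
  proof -
    have "r * (- h * S) / t * (r * s * X) + r * (- h * C) / t * (r * c * X)
        = - h * (s * S + c * C) * (r\<^sup>2 / t) * X" for r s c S C t X :: real
      by (simp add: power2_eq_square divide_inverse algebra_simps)
    then show ?thesis
      by (simp only: a_field_mode b_field_mode mode_field_def static_field_def inner_scaleR_left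
          inner_scaleR_right)
  qed
  also have "\<dots> = - h * ?s * ((radial chi k)\<^sup>2 * norm k) * (n $ m - k $ m * (k \<bullet> n) / (norm k)\<^sup>2)"
    using False by (simp add: c power2_eq_square)
  also have "\<dots> = (chi (norm k))\<^sup>2 * (kernel l k * (n $ m - k $ m * (k \<bullet> n) / (norm k)\<^sup>2))"
    by (simp add: radial_square[OF False] kernel_def s)
  finally show ?thesis .
qed

lemma B_field_static:
  "integrable lborel (\<lambda>k. (chi (norm k))\<^sup>2 * (kernel l k * (n $ m - k $ m * (k \<bullet> n) / (norm k)\<^sup>2)))"
  "B_field chi m (x l) q_static p_static
    = (LINT k|lborel. (chi (norm k))\<^sup>2 * (kernel l k * (n $ m - k $ m * (k \<bullet> n) / (norm k)\<^sup>2)))"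
  unfolding B_integrand[symmetric] B_field_def
  using Hspace_inner[OF modes_in_Hspace(1) static_in_Hspace(1), of m "x l"]
    Hspace_inner[OF modes_in_Hspace(2) static_in_Hspace(2), of m "x l"]
  by simp_all

text \<open>The component along \<open>n\<close> of the field at \<open>x l\<close>: contracting the
  transverse projection of \<open>n\<close> with \<open>n\<close> leaves 1 - (k . n)^2 /
  |k|^2.\<close>

definition mean_field :: "'n \<Rightarrow> real" where
  "mean_field l = (LINT k|lborel. (chi (norm k))\<^sup>2 * (kernel l k * (1 - (k \<bullet> n)\<^sup>2 / (norm k)\<^sup>2)))"

lemma transverse_weight_bound: "\<bar>1 - (k \<bullet> n)\<^sup>2 / (norm k)\<^sup>2\<bar> \<le> 1"
proof -
  have "(k \<bullet> n)\<^sup>2 \<le> (norm k)\<^sup>2"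
    using Cauchy_Schwarz_ineq2[of k n] norm_n by (simp add: abs_le_square_iff[symmetric])
  then have "(k \<bullet> n)\<^sup>2 / (norm k)\<^sup>2 \<le> 1" "0 \<le> (k \<bullet> n)\<^sup>2 / (norm k)\<^sup>2"
    by (simp_all add: divide_le_eq_1)
  then show ?thesis by linarith
qed

lemma integrable_phase:
  "integrable lborel (\<lambda>k. (chi (norm k))\<^sup>2 * (cos (k \<bullet> y) * (1 - (k \<bullet> n)\<^sup>2 / (norm k)\<^sup>2)))"
  by (rule integrable_chi_square_bounded[where M = 1], measurable)
     (use transverse_weight_bound in \<open>auto simp: abs_mult intro!: mult_le_one\<close>)

lemma mean_field_integrable:
  "integrable lborel (\<lambda>k. (chi (norm k))\<^sup>2 * (kernel l k * (1 - (k \<bullet> n)\<^sup>2 / (norm k)\<^sup>2)))"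
  and mean_field_eq: "mean_field l = - h * (\<Sum>r\<in>UNIV. \<epsilon> r * (inverse ((2 * pi) ^ 3) *
    (LINT k|lborel. (chi (norm k))\<^sup>2 * (cos (k \<bullet> (x l - x r)) * (1 - (k \<bullet> n)\<^sup>2 / (norm k)\<^sup>2)))))"
proof -
  have eq: "(chi (norm k))\<^sup>2 * (kernel l k * (1 - (k \<bullet> n)\<^sup>2 / (norm k)\<^sup>2))
    = (\<Sum>r\<in>UNIV. (- h * inverse ((2 * pi) ^ 3) * \<epsilon> r) *
       ((chi (norm k))\<^sup>2 * (cos (k \<bullet> (x l - x r)) * (1 - (k \<bullet> n)\<^sup>2 / (norm k)\<^sup>2))))" for k
    unfolding kernel_def sum_distrib_left sum_distrib_right
    by (intro sum.cong refl) (simp only: divide_inverse mult_ac)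
  show "integrable lborel (\<lambda>k. (chi (norm k))\<^sup>2 * (kernel l k * (1 - (k \<bullet> n)\<^sup>2 / (norm k)\<^sup>2)))"
    unfolding eq by (intro Bochner_Integration.integrable_sum integrable_mult_right integrable_phase)
  show "mean_field l = - h * (\<Sum>r\<in>UNIV. \<epsilon> r * (inverse ((2 * pi) ^ 3) *
    (LINT k|lborel. (chi (norm k))\<^sup>2 * (cos (k \<bullet> (x l - x r)) * (1 - (k \<bullet> n)\<^sup>2 / (norm k)\<^sup>2)))))"
    unfolding mean_field_def eq
    by (subst Bochner_Integration.integral_sum, intro integrable_mult_right integrable_phase)
       (simp only: integral_mult_right_zero sum_distrib_left, simp only: mult_ac)
qed

lemma B_field_static_parallel: "B_field chi m (x l) q_static p_static = n $ m * mean_field l"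
proof -
  \<comment> \<open>The integral of \<open>F\<close> is the difference of the two sides of the
    claim, so it has to vanish.\<close>
  define F where "F k = (chi (norm k))\<^sup>2 * (kernel l k * ((k $ m - n $ m * (k \<bullet> n)) * (k \<bullet> n) / (norm k)\<^sup>2))"
    for k
  \<comment> \<open>\<^term>\<open>R\<close> is the reflection in the plane orthogonal to \<^term>\<open>n\<close>. As the points are coplanar,
    it leaves the phases invariant, while the component of the integrand orthogonal to \<^term>\<open>n\<close>
    is odd.\<close>
  define R where "R k = k - (2 * (k \<bullet> n)) *\<^sub>R n" for k
  have nn: "n \<bullet> n = 1" using norm_n by (simp add: norm_eq_1)
  have split: "F k = n $ m * ((chi (norm k))\<^sup>2 * (kernel l k * (1 - (k \<bullet> n)\<^sup>2 / (norm k)\<^sup>2)))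
      - (chi (norm k))\<^sup>2 * (kernel l k * (n $ m - k $ m * (k \<bullet> n) / (norm k)\<^sup>2))" for k
    unfolding F_def by (simp add: diff_divide_distrib algebra_simps power2_eq_square)
  have intF: "integrable lborel F"
    unfolding split[abs_def] using mean_field_integrable B_field_static(1) by simp
  have Rn: "R k \<bullet> n = - (k \<bullet> n)" for k
    by (simp add: R_def inner_diff_left nn)
  have Rnorm: "norm (R k) = norm k" for k
    by (simp add: norm_eq_sqrt_inner R_def inner_diff_left inner_diff_right nn inner_commute[of n k])
  have Rx: "R k \<bullet> (x l - x r) = k \<bullet> (x l - x r)" for k r
    using coplanar[of l r] by (simp add: R_def inner_diff_left)
  have "linear R"
    unfolding R_def by (intro linearI) (simp_all add: inner_add_left algebra_simps)
  moreover have "R (R k) = k" for k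
    by (simp add: R_def[of "R k"] Rn) (simp add: R_def)
  \<comment> \<open>The factor containing \<open>k $ m\<close> is the component orthogonal to
    \<open>n\<close>, which \<open>R\<close> fixes; the factor \<open>k \<bullet> n\<close> changes
    sign.\<close>
  moreover have "F (R k) = - F k" for k
  proof -
    have "R k $ m - n $ m * (R k \<bullet> n) = k $ m - n $ m * (k \<bullet> n)"
      unfolding Rn by (simp add: R_def)
    then show ?thesis
      unfolding F_def kernel_def Rx Rn Rnorm by simp
  qed
  ultimately have "(LINT k|lborel. F k) = 0"
    using intF by (intro lborel_integral_odd_involution[of R])
  moreover have "(LINT k|lborel. F k) = n $ m * mean_field l - B_field chi m (x l) q_static p_static"
    unfolding split B_field_static(2) mean_field_def
    using mean_field_integrable B_field_static(1) by simp
  ultimately show ?thesis by simp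
qed

section \<open>Stationarity of the field and its energy\<close>

context
  fixes \<omega> :: "'n spin_op \<Rightarrow> real"
  assumes \<omega>: "\<omega> (i_sigma m l) = \<epsilon> l * n $ m"
begin

lemma rhs_q_static: "rhs_q chi x h q_static p_static \<omega> k = 0"
  and rhs_p_static: "rhs_p chi x h q_static p_static \<omega> k = 0"
  by (simp_all add: rhs_q_def rhs_p_def Mop_static_field_eq_sum a_field_mode b_field_mode \<omega>)

text \<open>A virial argument: the integrand is Mq . q + Mp . p, and replacing Mq and Mp by their
  sources turns it into the coupling of the spins to their own field, which is parallel to
  \<open>n\<close>.\<close>

lemma field_energy_static:
  "(LINT k|lborel. norm k * ((norm (q_static k))\<^sup>2 + (norm (p_static k))\<^sup>2))
    = - h * (\<Sum>l\<in>UNIV. \<epsilon> l * mean_field l)"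
proof -
  have "norm k * ((norm (q_static k))\<^sup>2 + (norm (p_static k))\<^sup>2)
      = Mop q_static k \<bullet> q_static k + Mop p_static k \<bullet> p_static k" for k
    by (simp add: Mop_def power2_norm_eq_inner distrib_left)
  also have "\<dots> k = - h * (\<Sum>l\<in>UNIV. \<Sum>m\<in>UNIV. (\<epsilon> l * n $ m) *
      (a_field chi m (x l) k \<bullet> q_static k + b_field chi m (x l) k \<bullet> p_static k))" for k
    unfolding Mop_static_field_eq_sum a_field_mode b_field_mode
    by (simp add: inner_sum_left distrib_left sum.distrib)
  finally have eq: "norm k * ((norm (q_static k))\<^sup>2 + (norm (p_static k))\<^sup>2)
      = - h * (\<Sum>l\<in>UNIV. \<Sum>m\<in>UNIV. (\<epsilon> l * n $ m) *
      ((chi (norm k))\<^sup>2 * (kernel l k * (n $ m - k $ m * (k \<bullet> n) / (norm k)\<^sup>2))))" for k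
    unfolding B_integrand .
  have "(LINT k|lborel. norm k * ((norm (q_static k))\<^sup>2 + (norm (p_static k))\<^sup>2))
    = - h * (\<Sum>l\<in>UNIV. \<Sum>m\<in>UNIV. (\<epsilon> l * n $ m) * B_field chi m (x l) q_static p_static)"
    unfolding eq B_field_static(2)
    using B_field_static(1) by (simp add: Bochner_Integration.integral_sum)
  also have "\<dots> = - h * (\<Sum>l\<in>UNIV. \<epsilon> l * mean_field l * (n \<bullet> n))"
    unfolding B_field_static_parallel inner_vec_def sum_distrib_left by (simp add: mult_ac)
  finally show ?thesis using norm_n by (simp add: norm_eq_1)
qed

text \<open>The interaction contributes h times the sum of
  \<open>\<epsilon> l * mean_field l\<close>, and the field energy takes back half of it.\<close>

lemma energy_static:
  "energy chi x \<beta> h q_static p_static \<omega>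
    = h * (\<beta> \<bullet> n) * (\<Sum>l\<in>UNIV. \<epsilon> l) + h / 2 * (\<Sum>l\<in>UNIV. \<epsilon> l * mean_field l)"
proof -
  have "(\<Sum>m\<in>UNIV. (\<beta> $ m + B_field chi m (x l) q_static p_static) * \<omega> (i_sigma m l))
      = \<epsilon> l * (\<beta> \<bullet> n) + \<epsilon> l * mean_field l * (n \<bullet> n)" for l
    unfolding B_field_static_parallel \<omega> inner_vec_def sum_distrib_left sum.distrib[symmetric]
    by (simp add: algebra_simps)
  moreover have "n \<bullet> n = 1" using norm_n by (simp add: norm_eq_1)
  ultimately have "(\<Sum>l\<in>UNIV. \<Sum>m\<in>UNIV. (\<beta> $ m + B_field chi m (x l) q_static p_static) * \<omega> (i_sigma m l))
      = (\<Sum>l\<in>UNIV. \<epsilon> l) * (\<beta> \<bullet> n) + (\<Sum>l\<in>UNIV. \<epsilon> l * mean_field l)"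
    by (simp only: sum.distrib sum_distrib_right mult_1_right)
  then show ?thesis
    unfolding energy_def field_energy_static by (simp add: algebra_simps)
qed

end

lemma mean_field_C33:
  assumes "n = axis 3 1"
  shows "mean_field l = - h * (\<Sum>r\<in>UNIV. \<epsilon> r * C33 chi x l r)"
proof -
  have "\<bar>chi (norm k)\<bar>\<^sup>2 * cos (k \<bullet> y) * (((k $ 1)\<^sup>2 + (k $ 2)\<^sup>2) / (norm k)\<^sup>2)
      = (chi (norm k))\<^sup>2 * (cos (k \<bullet> y) * (1 - (k \<bullet> n)\<^sup>2 / (norm k)\<^sup>2))" for k y
  proof (cases "k = 0")
    \<comment> \<open>At \<open>k = 0\<close> the two quotients are 0 by convention, so the weights
      are 0 and 1; that point is settled by \<open>chi_0\<close>.\<close>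
    case False
    have "(norm k)\<^sup>2 = (k $ 1)\<^sup>2 + (k $ 2)\<^sup>2 + (k $ 3)\<^sup>2"
      unfolding power2_norm_eq_inner by (simp add: inner_vec_def sum_3 power2_eq_square)
    then have "((k $ 1)\<^sup>2 + (k $ 2)\<^sup>2) / (norm k)\<^sup>2 = ((norm k)\<^sup>2 - (k \<bullet> n)\<^sup>2) / (norm k)\<^sup>2"
      by (simp add: assms inner_axis)
    then show ?thesis using False by (simp add: diff_divide_distrib)
  qed (simp add: chi_0)
  then show ?thesis unfolding mean_field_eq C33_def by simp
qed

end

theorem proposition6p3:
  fixes chi :: "real \<Rightarrow> real"
    and x :: "'n::finite \<Rightarrow> real^3"
    and \<beta> :: "real^3"
    and b0 b1 :: "complex^2"
    and E :: "'n set"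
  assumes "schwartz chi" and "vanishes_near_zero chi"
    and "norm b0 = 1" and "sigma_dot \<beta> b0 = - (complex_of_real (norm \<beta>) *s b0)"
    and "norm b1 = 1" and "sigma_dot \<beta> b1 = complex_of_real (norm \<beta>) *s b1"
    and "\<beta> \<noteq> 0"
    and "\<exists>c. \<forall>l. \<beta> \<bullet> x l = c"
  shows "\<forall>h>0. \<exists>q\<in>Hspace. \<exists>p\<in>Hspace.
           fixed_point chi x \<beta> h q p (pure_state (a_state b0 b1 E)) \<and>
           (\<beta> = vector [0, 0, norm \<beta>] \<longrightarrow>
              energy chi x \<beta> h q p (pure_state (a_state b0 b1 E)) =
                h * norm \<beta> * (\<Sum>l\<in>UNIV. spin_sign E l)
                - h\<^sup>2 / 2 * (\<Sum>l\<in>UNIV. \<Sum>r\<in>UNIV.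
                    C33 chi x l r * spin_sign E l * spin_sign E r))"
proof (intro allI impI)
  fix h :: real
  define n where "n = \<beta> /\<^sub>R norm \<beta>"
  define v where "v l = (if l \<in> E then b1 else b0)" for l
  let ?a = "a_state b0 b1 E" and ?\<omega> = "pure_state (a_state b0 b1 E)"
  have norm_n: "norm n = 1"
    using \<open>\<beta> \<noteq> 0\<close> by (simp add: n_def)
  have a: "?a = tensor_vec v"
    by (simp add: a_state_def v_def[abs_def])
  have v: "norm (v l) = 1"
    "sigma_dot \<beta> (v l) = complex_of_real (spin_sign E l * norm \<beta>) *s v l" for l
    using assms(3-6) by (simp_all add: v_def spin_sign_def)
  interpret aligned_spins chi x n "spin_sign E" h
  proof
    show "n \<bullet> (x l - x r) = 0" for l r
      using assms(8) by (auto simp: n_def inner_diff_right)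
  qed (use assms(1,2) norm_n in auto)
  have sign: "spin_sign E l * spin_sign E l = 1" for l by (simp add: spin_sign_def)
  have \<omega>: "?\<omega> (i_sigma m l) = spin_sign E l * n $ m" for m l
  proof -
    have "spin_sign E l * norm \<beta> * ?\<omega> (i_sigma m l) = \<beta> $ m"
      unfolding a by (rule pure_state_i_sigma[where v = v and l = l, OF v(1) v(2)])
    also have "\<beta> $ m = norm \<beta> * n $ m"
      using \<open>\<beta> \<noteq> 0\<close> by (simp add: n_def)
    \<comment> \<open>The eigenvalue is the sign times |\<beta>|; cancel |\<beta>|, then multiply by
      the sign, whose square is 1.\<close>
    finally have "n $ m = spin_sign E l * ?\<omega> (i_sigma m l)"
      using \<open>\<beta> \<noteq> 0\<close> by simp
    then show ?thesis by (simp only: mult.assoc[symmetric] sign mult_1)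
  qed
  have "rhs_omega chi x \<beta> q_static p_static ?\<omega> Y = 0" if "Y \<in> lie_G" for Y
  proof -
    \<comment> \<open>As \<open>n\<close> is \<open>\<beta>\<close> divided by its norm, external
      and generated field add up to a multiple of \<open>\<beta>\<close>, so the eigenvector
      property for \<open>\<beta>\<close> suffices.\<close>
    have "(\<Sum>m\<in>UNIV. (\<beta> $ m + B_field chi m (x l) q_static p_static)
        * ?\<omega> (commutator (i_sigma m l) Y))
      = (1 + mean_field l / norm \<beta>) *
        (\<Sum>m\<in>UNIV. \<beta> $ m * ?\<omega> (commutator (i_sigma m l) Y))" for l
      using \<open>\<beta> \<noteq> 0\<close> unfolding B_field_static_parallel sum_distrib_left
      by (intro sum.cong refl) (simp add: n_def field_simps)
    also have "\<dots> l = 0" for l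
      using sum_pure_state_commutator_eq_0[of \<beta> v l, OF v(2) that] by (simp add: a)
    finally show ?thesis by (simp add: rhs_omega_def)
  qed
  then have "fixed_point chi x \<beta> h q_static p_static ?\<omega>"
    by (simp add: fixed_point_def static_in_dom_M pure_state_in_dual_G rhs_q_static[OF \<omega>]
        rhs_p_static[OF \<omega>])
  moreover have "energy chi x \<beta> h q_static p_static ?\<omega> =
      h * norm \<beta> * (\<Sum>l\<in>UNIV. spin_sign E l)
      - h\<^sup>2 / 2 * (\<Sum>l\<in>UNIV. \<Sum>r\<in>UNIV. C33 chi x l r * spin_sign E l * spin_sign E r)"
    if "\<beta> = vector [0, 0, norm \<beta>]"
  proof -
    have "\<beta> $ 1 = 0" "\<beta> $ 2 = 0" "\<beta> $ 3 = norm \<beta>"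
      by (metis that vector_3)+
    then have n3: "n = axis 3 1"
      using \<open>\<beta> \<noteq> 0\<close> unfolding vec_eq_iff forall_3 by (simp add: n_def axis_def)
    have "\<beta> \<bullet> n = norm \<beta>"
      using \<open>\<beta> \<noteq> 0\<close> by (simp add: n_def dot_square_norm power2_eq_square)
    then show ?thesis
      unfolding energy_static[OF \<omega>] mean_field_C33[OF n3]
      by (simp add: sum_distrib_left sum_negf power2_eq_square mult_ac)
  qed
  ultimately show "\<exists>q\<in>Hspace. \<exists>p\<in>Hspace.
           fixed_point chi x \<beta> h q p (pure_state (a_state b0 b1 E)) \<and>
           (\<beta> = vector [0, 0, norm \<beta>] \<longrightarrow>
              energy chi x \<beta> h q p (pure_state (a_state b0 b1 E)) =
                h * norm \<beta> * (\<Sum>l\<in>UNIV. spin_sign E l)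
                - h\<^sup>2 / 2 * (\<Sum>l\<in>UNIV. \<Sum>r\<in>UNIV.
                    C33 chi x l r * spin_sign E l * spin_sign E r))"
    using static_in_Hspace by blast
qed

end
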